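(* Let $K$ be a finite set, let $k(x,y)\ge 0$ ($x\ne y\in K$) be the transition rates of an irreducible Markov jump process $X_t$ on $K$ with backward generator $L$ and unique stationary distribution $\rho^s$. Let $f:K\to\mathbb{R}$ with $\sum_x\rho^s(x)f(x)=0$, and suppose there exist a set $\mathcal{D}\subset K$ and functions $E,h_E:K\to\mathbb{R}$ such that $f(x)=LE(x)+h_E(x)$ for all $x\in K$ and $h_E(x)=0$ for $x\notin\mathcal{D}$. Then any solution $V:K\to\mathbb{R}$ of the Poisson equation $LV(x)+f(x)=0$, $x\in K$, satisfies for all $x,y\in K$ $$|V(x)-V(y)|\le |E(x)-E(y)|+\|h_E\|\sum_{z\in\mathcal{D}}\rho^s(z)\,|\tau(x,z)-\tau(y,z)|,$$ where $\tau(x,z)$ is the mean first-passage time to reach $z$ from $x$ and $\|h_E\|=\max_{z\in K}|h_E(z)|$.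
   Context: The backward generator acts on functions $g:K\to\mathbb{R}$ by $Lg(x)=\sum_y k(x,y)[g(y)-g(x)]$. Irreducibility means that the digraph with vertex set $K$ and arcs $(x,y)$ for $k(x,y)>0$ is strongly connected. The stationary distribution $\rho^s>0$ is the unique probability distribution with $\rho^sL=0$. The mean first-passage time is $\tau(x,z)=\langle\inf\{t\ge0: X_t=z\}\mid X_0=x\rangle$; equivalently, for each fixed $z$ it is the solution of $\sum_y k(x,y)[\tau(y,z)-\tau(x,z)]+1=0$ for $x\ne z$ with $\tau(z,z)=0$. *)

theory Defs
  imports "HOL-Probability.Probability"
begin

text \<open>
  The finite state space \<open>K\<close> is a type of class \<^class>\<open>finite\<close>. Rates are a function
  \<open>k\<close> of which only the off-diagonal values matter: the diagonal drops out below.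
\<close>

definition backward_generator ::
  "('a::finite \<Rightarrow> 'a \<Rightarrow> real) \<Rightarrow> ('a \<Rightarrow> real) \<Rightarrow> 'a \<Rightarrow> real"
  where "backward_generator k g x = (\<Sum>y\<in>UNIV. k x y * (g y - g x))"

definition irreducible_rates :: "('a::finite \<Rightarrow> 'a \<Rightarrow> real) \<Rightarrow> bool"
  where "irreducible_rates k \<longleftrightarrow>
    (\<forall>x y. (x, y) \<in> {(u, v). u \<noteq> v \<and> k u v > 0}\<^sup>*)"

text \<open>The equation \<open>\<rho> L = 0\<close> for the row vector \<open>\<rho>\<close>, tested on all functions.\<close>

definition stationary_distribution :: "('a::finite \<Rightarrow> 'a \<Rightarrow> real) \<Rightarrow> 'a pmf \<Rightarrow> bool"
  where "stationary_distribution k rho \<longleftrightarrow>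
    (\<forall>g. (\<Sum>x\<in>UNIV. pmf rho x * backward_generator k g x) = 0)"

text \<open>
  \<open>P x\<close> is the law of the process started in \<open>x\<close>; only times \<open>t \<ge> 0\<close> matter. The Markov
  property is stated on finite-dimensional cylinder events: given the states at the times in
  \<open>J\<close> before \<open>s\<close> and the state \<open>a\<close> at time \<open>s\<close>, the process restarts from \<open>a\<close>. The diagonal
  behaviour of the transition probabilities at small times follows from \<open>rates\<close>, since they
  sum to \<open>1\<close>. The last assumption is right-continuity of the paths for the discrete topology
  on the state space.
\<close>

locale markov_jump_process =
  fixes k :: "'a::finite \<Rightarrow> 'a \<Rightarrow> real"
    and P :: "'a \<Rightarrow> 'w measure"
    and X :: "real \<Rightarrow> 'w \<Rightarrow> 'a"
  assumes prob: "prob_space (P x)"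
    and measurable_X: "0 \<le> t \<Longrightarrow> X t \<in> measurable (P x) (count_space UNIV)"
    and initial: "AE \<omega> in P x. X 0 \<omega> = x"
    and markov: "\<lbrakk>finite J; J \<subseteq> {0..s}; 0 \<le> s; 0 \<le> t\<rbrakk> \<Longrightarrow>
      measure (P x) {\<omega> \<in> space (P x). (\<forall>u\<in>J. X u \<omega> = c u) \<and> X s \<omega> = a \<and> X (s + t) \<omega> = b}
      = measure (P x) {\<omega> \<in> space (P x). (\<forall>u\<in>J. X u \<omega> = c u) \<and> X s \<omega> = a}
        * measure (P a) {\<omega> \<in> space (P a). X t \<omega> = b}"
    and rates: "x \<noteq> y \<Longrightarrow>
      ((\<lambda>t. measure (P x) {\<omega> \<in> space (P x). X t \<omega> = y} / t) \<longlongrightarrow> k x y) (at_right 0)"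
    and right_continuous:
      "AE \<omega> in P x. \<forall>t\<ge>0. \<forall>\<^sub>F s in at_right t. X s \<omega> = X t \<omega>"

text \<open>Extended values are used so that a path that never reaches \<open>z\<close> gets the value \<open>\<infinity>\<close>.\<close>

definition first_passage_time :: "(real \<Rightarrow> 'w \<Rightarrow> 'a) \<Rightarrow> 'a \<Rightarrow> 'w \<Rightarrow> ennreal"
  where "first_passage_time X z \<omega> = Inf (ennreal ` {t. 0 \<le> t \<and> X t \<omega> = z})"

text \<open>
  For irreducible rates the integral is finite, so the convention \<open>enn2real \<infinity> = 0\<close> plays no role.
\<close>

definition mean_first_passage_time ::
  "('a \<Rightarrow> 'w measure) \<Rightarrow> (real \<Rightarrow> 'w \<Rightarrow> 'a) \<Rightarrow> 'a \<Rightarrow> 'a \<Rightarrow> real"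
  where "mean_first_passage_time P X x z =
    enn2real (\<integral>\<^sup>+\<omega>. first_passage_time X z \<omega> \<partial>P x)"

definition max_norm :: "('a::finite \<Rightarrow> real) \<Rightarrow> real"
  where "max_norm h = Max (range (\<lambda>z. \<bar>h z\<bar>))"

end

theory Submission
  imports Defs
begin

text \<open>
  Put \<open>W = V + E\<close>. The Poisson equation and the decomposition of \<open>f\<close> give \<open>L W = - h\<^sub>E\<close>, so
  the source left over lives on \<open>D\<close>. Mean first-passage times invert \<open>L\<close> against such a source:
  \<open>L \<tau>(\<cdot>,z) = - 1\<close> off \<open>z\<close>, and pairing with \<open>\<rho>\<close> determines the value at \<open>z\<close>, so that
  \<open>\<rho>(z) L \<tau>(\<cdot>,z) = \<delta>\<^sub>z - \<rho>(z)\<close> at every state. Since \<open>h\<^sub>E\<close> is centered (because \<open>f\<close> and \<open>L E\<close>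
  are), \<open>U = \<Sum>\<^sub>z h\<^sub>E(z) \<rho>(z) \<tau>(\<cdot>,z)\<close> satisfies \<open>L U = h\<^sub>E\<close>. Hence \<open>V + E + U\<close> is harmonic, and
  by irreducibility constant (\<open>harmonic_imp_const\<close>). The inequality is the triangle inequality for
  \<open>V(x) - V(y) = - (E(x) - E(y)) - (U(x) - U(y))\<close>.

  What remains is that \<open>\<tau>\<close>, defined by an integral over paths, solves the boundary
  value problem \<open>L w = - 1\<close> off \<open>z\<close>, \<open>w(z) = 0\<close>. A nonnegative solution \<open>w\<close> exists by linear
  algebra and the maximum principle (\<open>ex_hitting_solution\<close>). It is compared with the first passage
  time \<open>T\<^sub>h\<close> observed on the time grid \<open>h \<nat>\<close>, where only finite-dimensional distributions
  enter. Along the grid chain killed at \<open>z\<close>, the expectation of \<open>w\<close> drops in each step by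
  \<open>h + o(h)\<close> times the probability of being still alive; summing over the steps gives
  \<open>\<langle>T\<^sub>h\<rangle> \<rightarrow> w\<close> as \<open>h \<rightarrow> 0\<close> (\<open>sum_alive_bounds\<close>, \<open>drift_tendsto\<close>). On the grids \<open>h = 2\<^sup>-\<^sup>n\<close> the times
  \<open>T\<^sub>h\<close> decrease, for right-continuous paths, to the true first passage time
  (\<open>INF_grid_passage_time\<close>), and monotone convergence yields \<open>\<tau>(\<cdot>,z) = w\<close>
  (\<open>mean_first_passage_time_eqI\<close>). The same comparison shows that \<open>\<langle>T\<^sub>h\<rangle>\<close> is finite for small
  \<open>h\<close>, as monotone convergence from above requires.
\<close>

section \<open>The maximum principle\<close>

text \<open>
  At a maximizer other than \<open>z\<close> all terms of the generator sum are nonpositive while the sum is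
  nonnegative, so every neighbour is again a maximizer; by irreducibility maximality travels
  along a path to \<open>z\<close>.
\<close>

lemma max_principle:
  fixes k :: "'a::finite \<Rightarrow> 'a \<Rightarrow> real"
  assumes nonneg: "\<And>x y. x \<noteq> y \<Longrightarrow> 0 \<le> k x y"
    and irr: "irreducible_rates k"
    and sub: "\<And>x. x \<noteq> z \<Longrightarrow> 0 \<le> backward_generator k g x"
  shows "g x \<le> g z"
proof -
  define m where "m = Max (range g)"
  have le_m: "g y \<le> m" for y
    unfolding m_def by (rule Max_ge) auto
  have "m \<in> range g"
    unfolding m_def by (rule Max_in) auto
  then obtain x0 where x0: "g x0 = m"
    by auto
  have propagate: "g v = m" if "u \<noteq> z" "u \<noteq> v" "k u v > 0" "g u = m" for u v
  proof -
    have neg: "k u y * (g y - g u) \<le> 0" for y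
      using nonneg[of u y] le_m[of y] that(4) by (cases "u = y") (auto intro: mult_nonneg_nonpos)
    have "(\<Sum>y\<in>UNIV. k u y * (g y - g u)) \<le> 0"
      by (rule sum_nonpos) (rule neg)
    then have "(\<Sum>y\<in>UNIV. - (k u y * (g y - g u))) = 0"
      using sub[OF that(1)]
      unfolding backward_generator_def sum_negf by linarith
    then have "k u v * (g v - g u) = 0"
      using neg by (subst (asm) sum_nonneg_eq_0_iff) auto
    then show ?thesis
      using that by simp
  qed
  have "(x0, z) \<in> {(u, v). u \<noteq> v \<and> k u v > 0}\<^sup>*"
    using irr unfolding irreducible_rates_def by blast
  then have "g x0 = m \<longrightarrow> g z = m"
  proof (induction rule: converse_rtrancl_induct)
    case (step u v)
    from step(1) have "u \<noteq> v" "k u v > 0"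
      by simp_all
    show ?case
    proof
      assume "g u = m"
      show "g z = m"
      proof (cases "u = z")
        case False
        have "g v = m"
          by (rule propagate) fact+
        with step.IH show ?thesis
          by simp
      qed (use \<open>g u = m\<close> in simp)
    qed
  qed simp
  then show ?thesis
    using x0 le_m by simp
qed

lemma backward_generator_uminus: "backward_generator k (\<lambda>x. - g x) x = - backward_generator k g x"
  unfolding backward_generator_def by (simp add: sum_negf[symmetric] algebra_simps)

lemma backward_generator_add:
  "backward_generator k (\<lambda>x. g x + h x) x = backward_generator k g x + backward_generator k h x"
  unfolding backward_generator_def by (simp add: sum.distrib[symmetric] algebra_simps)

lemma backward_generator_scale:
  "backward_generator k (\<lambda>x. c * g x) x = c * backward_generator k g x"
  unfolding backward_generator_def by (simp add: sum_distrib_left algebra_simps)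

lemma backward_generator_sum:
  "backward_generator k (\<lambda>x. \<Sum>z\<in>A. g z x) x = (\<Sum>z\<in>A. backward_generator k (g z) x)"
  unfolding backward_generator_def sum_subtractf[symmetric] sum_distrib_left by (rule sum.swap)

lemma harmonic_imp_const:
  assumes "\<And>x y. x \<noteq> y \<Longrightarrow> 0 \<le> k x y" "irreducible_rates k"
    and "\<And>x. backward_generator k g x = 0"
  shows "g x = g y"
  by (rule order.antisym) (rule max_principle[OF assms(1,2)], auto simp: assms(3))+

text \<open>
  The Dirichlet problem is a square linear system, so its solvability follows from uniqueness,
  which the maximum principle gives.
\<close>

lemma ex_hitting_solution:
  fixes k :: "'a::finite \<Rightarrow> 'a \<Rightarrow> real"
  assumes nonneg: "\<And>x y. x \<noteq> y \<Longrightarrow> 0 \<le> k x y"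
    and irr: "irreducible_rates k"
  obtains w where "w z = 0" "\<And>x. x \<noteq> z \<Longrightarrow> backward_generator k w x = -1" "\<And>x. 0 \<le> w x"
proof -
  define F :: "real^'a \<Rightarrow> real^'a" where
    "F g = (\<chi> x. if x = z then g $ z else backward_generator k (($) g) x)" for g
  have lin: "linear F"
    by (rule linearI)
      (auto simp: F_def vec_eq_iff backward_generator_def sum.distrib[symmetric] sum_distrib_left
        algebra_simps)
  have "inj F"
    unfolding linear_injective_0[OF lin]
  proof (intro allI impI)
    fix g assume "F g = 0"
    then have eq: "(if x = z then g $ z else backward_generator k (($) g) x) = 0" for x
      by (auto simp: F_def vec_eq_iff)
    have 0: "g $ z = 0" "\<And>x. x \<noteq> z \<Longrightarrow> backward_generator k (($) g) x = 0"
      using eq by (metis (mono_tags))+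
    have "g $ x \<le> g $ z" for x
      by (rule max_principle[OF nonneg irr]) (auto simp: 0)
    moreover have "- g $ x \<le> - g $ z" for x
      by (rule max_principle[OF nonneg irr, where g = "\<lambda>x. - g $ x"])
        (auto simp: 0 backward_generator_uminus)
    ultimately show "g = 0"
      by (auto simp: vec_eq_iff 0(1) intro!: order.antisym)
  qed
  then have "surj F"
    using lin linear_injective_imp_surjective by blast
  then obtain g where "F g = (\<chi> x. if x = z then 0 else -1)"
    by (metis surjD)
  then have g: "(if x = z then g $ z else backward_generator k (($) g) x) = (if x = z then 0 else -1)" for x
    by (auto simp: F_def vec_eq_iff)
  have 1: "g $ z = 0" "\<And>x. x \<noteq> z \<Longrightarrow> backward_generator k (($) g) x = -1"
    using g by (metis (mono_tags))+
  moreover have "0 \<le> g $ x" for x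
    using max_principle[OF nonneg irr, where g = "\<lambda>x. - g $ x" and z = z and x = x] 1
    by (auto simp: backward_generator_uminus)
  ultimately show ?thesis
    using that[of "($) g"] by blast
qed

section \<open>The process on a time grid\<close>

context markov_jump_process
begin

definition transition :: "real \<Rightarrow> 'a \<Rightarrow> 'a \<Rightarrow> real"
  where "transition t x y = measure (P x) {\<omega> \<in> space (P x). X t \<omega> = y}"

lemma sets_X_mem [simp]:
  assumes "0 \<le> t"
  shows "{\<omega> \<in> space (P x). X t \<omega> \<in> A} \<in> sets (P x)"
proof -
  have "X t -` A \<inter> space (P x) \<in> sets (P x)"
    using measurable_X[OF assms] by (rule measurable_sets) auto
  then show ?thesis
    by (simp add: vimage_def Int_def conj_commute)
qed

lemma sets_X [simp]: "0 \<le> t \<Longrightarrow> {\<omega> \<in> space (P x). X t \<omega> = y} \<in> sets (P x)"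
  using sets_X_mem[of t x "{y}"] by simp

lemma sum_transition:
  assumes "0 \<le> t"
  shows "(\<Sum>y\<in>UNIV. transition t x y) = 1"
proof -
  interpret prob_space "P x" by (rule prob)
  have "(\<Sum>y\<in>UNIV. transition t x y) = prob (\<Union>y. {\<omega> \<in> space (P x). X t \<omega> = y})"
    unfolding transition_def using assms
    by (intro finite_measure_finite_Union[symmetric]) (auto simp: disjoint_family_on_def)
  also have "(\<Union>y. {\<omega> \<in> space (P x). X t \<omega> = y}) = space (P x)"
    by auto
  finally show ?thesis
    by (simp add: prob_space)
qed

text \<open>
  The diagonal rate never has to be computed: as transition probabilities sum to \<open>1\<close>, the
  difference quotient only involves \<open>g y - g x\<close>, which vanishes at \<open>y = x\<close>.
\<close>

lemma drift_tendsto: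
  "((\<lambda>h. ((\<Sum>y\<in>UNIV. transition h x y * g y) - g x) / h) \<longlongrightarrow> backward_generator k g x) (at_right 0)"
proof (rule Lim_transform_eventually)
  have "((\<lambda>h. transition h x y / h * (g y - g x)) \<longlongrightarrow> k x y * (g y - g x)) (at_right 0)" for y
  proof (cases "x = y")
    case False
    then show ?thesis
      unfolding transition_def by (intro tendsto_intros rates)
  qed simp
  then show "((\<lambda>h. \<Sum>y\<in>UNIV. transition h x y / h * (g y - g x)) \<longlongrightarrow> backward_generator k g x) (at_right 0)"
    unfolding backward_generator_def by (intro tendsto_sum)
next
  show "\<forall>\<^sub>F h in at_right 0. (\<Sum>y\<in>UNIV. transition h x y / h * (g y - g x)) =
      ((\<Sum>y\<in>UNIV. transition h x y * g y) - g x) / h"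
    using eventually_at_right_less[of 0]
  proof eventually_elim
    case (elim h)
    have "(\<Sum>y\<in>UNIV. transition h x y * (g y - g x))
        = (\<Sum>y\<in>UNIV. transition h x y * g y) - (\<Sum>y\<in>UNIV. transition h x y) * g x"
      by (simp add: sum_subtractf right_diff_distrib sum_distrib_right)
    then have "(\<Sum>y\<in>UNIV. transition h x y * (g y - g x)) = (\<Sum>y\<in>UNIV. transition h x y * g y) - g x"
      using elim by (simp add: sum_transition)
    then show ?case
      by (simp flip: sum_divide_distrib)
  qed
qed

text \<open>
  The Markov property for a past event that restricts the states to \<open>A\<close> instead of
  prescribing them: such an event is a finite disjoint union of cylinders, one for each function
  from \<open>J\<close> to \<open>A\<close>.
\<close>

lemma markov_set:
  assumes J: "finite J" "J \<subseteq> {0..s}" "0 \<le> s" and "0 \<le> t"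
  shows "measure (P x) {\<omega> \<in> space (P x). (\<forall>u\<in>J. X u \<omega> \<in> A) \<and> X s \<omega> = a \<and> X (s + t) \<omega> = b}
    = measure (P x) {\<omega> \<in> space (P x). (\<forall>u\<in>J. X u \<omega> \<in> A) \<and> X s \<omega> = a} * transition t a b"
proof -
  interpret prob_space "P x" by (rule prob)
  have split: "prob {\<omega> \<in> space (P x). (\<forall>u\<in>J. X u \<omega> \<in> A) \<and> Q \<omega>}
      = (\<Sum>c\<in>PiE J (\<lambda>_. A). prob {\<omega> \<in> space (P x). (\<forall>u\<in>J. X u \<omega> = c u) \<and> Q \<omega>})"
    if Q: "{\<omega> \<in> space (P x). Q \<omega>} \<in> sets (P x)" for Q
  proof -
    have eq: "{\<omega> \<in> space (P x). (\<forall>u\<in>J. X u \<omega> \<in> A) \<and> Q \<omega>}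
        = (\<Union>c\<in>PiE J (\<lambda>_. A). {\<omega> \<in> space (P x). (\<forall>u\<in>J. X u \<omega> = c u) \<and> Q \<omega>})"
    proof (intro set_eqI iffI)
      fix \<omega> assume "\<omega> \<in> {\<omega> \<in> space (P x). (\<forall>u\<in>J. X u \<omega> \<in> A) \<and> Q \<omega>}"
      then show "\<omega> \<in> (\<Union>c\<in>PiE J (\<lambda>_. A). {\<omega> \<in> space (P x). (\<forall>u\<in>J. X u \<omega> = c u) \<and> Q \<omega>})"
        by (intro UN_I[of "restrict (\<lambda>u. X u \<omega>) J"]) auto
    qed (auto simp: PiE_mem)
    have meas: "{\<omega> \<in> space (P x). (\<forall>u\<in>J. X u \<omega> = c u) \<and> Q \<omega>} \<in> sets (P x)" for c
      using J by (intro sets.sets_Collect_conj sets.sets_Collect_finite_All Q sets_X) auto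
    have "disjoint_family_on (\<lambda>c. {\<omega> \<in> space (P x). (\<forall>u\<in>J. X u \<omega> = c u) \<and> Q \<omega>}) (PiE J (\<lambda>_. A))"
      unfolding disjoint_family_on_def
    proof (intro ballI impI equals0I)
      fix c d \<omega>
      assume cd: "c \<in> PiE J (\<lambda>_. A)" "d \<in> PiE J (\<lambda>_. A)" "c \<noteq> d"
        and om: "\<omega> \<in> {\<omega> \<in> space (P x). (\<forall>u\<in>J. X u \<omega> = c u) \<and> Q \<omega>} \<inter>
          {\<omega> \<in> space (P x). (\<forall>u\<in>J. X u \<omega> = d u) \<and> Q \<omega>}"
      have "c = d"
        by (rule PiE_ext[OF cd(1,2)]) (use om in force)
      then show False
        using cd(3) by simp
    qed
    then show ?thesis
      unfolding eq using J(1) meas by (intro finite_measure_finite_Union) (auto intro!: finite_PiE)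
  qed
  have ms: "{\<omega> \<in> space (P x). X s \<omega> = a} \<in> sets (P x)"
    "{\<omega> \<in> space (P x). X s \<omega> = a \<and> X (s + t) \<omega> = b} \<in> sets (P x)"
    using assms by (auto intro!: sets.sets_Collect_conj)
  show ?thesis
    unfolding split[OF ms(1)] split[OF ms(2)] sum_distrib_right transition_def
    by (intro sum.cong refl markov assms)
qed

definition alive :: "real \<Rightarrow> 'a \<Rightarrow> 'a \<Rightarrow> nat \<Rightarrow> 'w set"
  where "alive h z x n = {\<omega> \<in> space (P x). \<forall>i\<le>n. X (real i * h) \<omega> \<noteq> z}"

definition alive_at :: "real \<Rightarrow> 'a \<Rightarrow> 'a \<Rightarrow> nat \<Rightarrow> 'a \<Rightarrow> real"
  where "alive_at h z x n a = measure (P x) {\<omega> \<in> alive h z x n. X (real n * h) \<omega> = a}"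

lemma sets_alive: "0 \<le> h \<Longrightarrow> alive h z x n \<in> sets (P x)"
  unfolding alive_def
  using sets.sets_Collect_finite_All[of "{..n}" "P x" "\<lambda>i \<omega>. X (real i * h) \<omega> \<noteq> z"]
    sets_X_mem[of _ x "-{z}"] by auto

lemma sets_alive_at: "0 \<le> h \<Longrightarrow> {\<omega> \<in> alive h z x n. X (real n * h) \<omega> = a} \<in> sets (P x)"
proof -
  assume h: "0 \<le> h"
  have "{\<omega> \<in> alive h z x n. X (real n * h) \<omega> = a}
      = alive h z x n \<inter> {\<omega> \<in> space (P x). X (real n * h) \<omega> = a}"
    by (auto simp: alive_def)
  then show ?thesis
    using h sets_alive sets_X by (simp add: sets.Int)
qed

lemma sum_alive_at:
  assumes "0 \<le> h"
  shows "(\<Sum>a\<in>UNIV. alive_at h z x n a) = measure (P x) (alive h z x n)"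
proof -
  interpret prob_space "P x" by (rule prob)
  have "(\<Sum>a\<in>UNIV. alive_at h z x n a) = prob (\<Union>a. {\<omega> \<in> alive h z x n. X (real n * h) \<omega> = a})"
    unfolding alive_at_def using sets_alive_at[OF assms]
    by (intro finite_measure_finite_Union[symmetric]) (auto simp: disjoint_family_on_def)
  also have "(\<Union>a. {\<omega> \<in> alive h z x n. X (real n * h) \<omega> = a}) = alive h z x n"
    by auto
  finally show ?thesis .
qed

lemma alive_at_target: "alive_at h z x n z = 0"
proof -
  have "{\<omega> \<in> alive h z x n. X (real n * h) \<omega> = z} = {}"
    by (auto simp: alive_def)
  then show ?thesis
    unfolding alive_at_def by (simp only: measure_empty)
qed

lemma alive_at_Suc:
  assumes h: "0 \<le> h" and b: "b \<noteq> z"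
  shows "alive_at h z x (Suc n) b = (\<Sum>a\<in>UNIV. alive_at h z x n a * transition h a b)"
proof -
  interpret prob_space "P x" by (rule prob)
  define J where "J = (\<lambda>i. real i * h) ` {..n}"
  have J: "finite J" "J \<subseteq> {0..real n * h}" "0 \<le> real n * h"
    using h by (auto simp: J_def mult_right_mono)
  have alive_J: "alive h z x n = {\<omega> \<in> space (P x). \<forall>u\<in>J. X u \<omega> \<in> - {z}}"
    by (auto simp: alive_def J_def)
  have Suc_h: "real (Suc n) * h = real n * h + h"
    by (simp add: algebra_simps)
  have meas: "{\<omega> \<in> space (P x). (\<forall>u\<in>J. X u \<omega> \<in> - {z}) \<and> X (real n * h) \<omega> = a \<and> X (real n * h + h) \<omega> = b}
      \<in> sets (P x)" for a
    using J h by (intro sets.sets_Collect_conj sets.sets_Collect_finite_All sets_X_mem sets_X) auto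
  have "{\<omega> \<in> alive h z x (Suc n). X (real (Suc n) * h) \<omega> = b}
      = {\<omega> \<in> alive h z x n. X (real n * h + h) \<omega> = b}"
    using b unfolding alive_def Suc_h[symmetric] by (auto simp: le_Suc_eq)
  also have "\<dots> = (\<Union>a. {\<omega> \<in> space (P x). (\<forall>u\<in>J. X u \<omega> \<in> - {z}) \<and> X (real n * h) \<omega> = a
      \<and> X (real n * h + h) \<omega> = b})"
    unfolding alive_J by auto
  finally have "alive_at h z x (Suc n) b = (\<Sum>a\<in>UNIV. prob {\<omega> \<in> space (P x). (\<forall>u\<in>J. X u \<omega> \<in> - {z})
      \<and> X (real n * h) \<omega> = a \<and> X (real n * h + h) \<omega> = b})"
    unfolding alive_at_def using meas
    by (simp only:) (intro finite_measure_finite_Union, auto simp: disjoint_family_on_def)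
  also have "\<dots> = (\<Sum>a\<in>UNIV. alive_at h z x n a * transition h a b)"
    unfolding markov_set[OF J h] alive_at_def alive_J by (simp add: conj_assoc)
  finally show ?thesis .
qed

lemma alive_at_0: "alive_at h z x 0 a = (if a = x \<and> x \<noteq> z then 1 else 0)"
proof -
  interpret prob_space "P x" by (rule prob)
  have "prob {\<omega> \<in> alive h z x 0. X (real 0 * h) \<omega> = a}
      = prob {\<omega> \<in> space (P x). a = x \<and> x \<noteq> z}"
  proof (rule measure_eq_AE)
    show "AE \<omega> in P x. \<omega> \<in> {\<omega> \<in> alive h z x 0. X (real 0 * h) \<omega> = a} \<longleftrightarrow>
        \<omega> \<in> {\<omega> \<in> space (P x). a = x \<and> x \<noteq> z}"
      using initial[of x] by eventually_elim (auto simp: alive_def)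
    have "{\<omega> \<in> alive h z x 0. X (real 0 * h) \<omega> = a}
        = {\<omega> \<in> space (P x). X 0 \<omega> \<in> -{z}} \<inter> {\<omega> \<in> space (P x). X 0 \<omega> = a}"
      by (auto simp: alive_def)
    then show "{\<omega> \<in> alive h z x 0. X (real 0 * h) \<omega> = a} \<in> sets (P x)"
      by (simp only:) (intro sets.Int sets_X_mem sets_X order.refl)
  qed auto
  then show ?thesis
    unfolding alive_at_def by (auto simp: prob_space)
qed

text \<open>
  A discrete Dynkin formula. With \<open>M n\<close> the expectation of \<open>w\<close> at step \<open>n\<close> over the paths
  alive so far, the condition \<open>w z = 0\<close> makes the mass killed at \<open>z\<close> contribute nothing, and the
  decrement \<open>M n - M (Suc n)\<close> lies between \<open>c1 * h\<close> and \<open>c2 * h\<close> times the probability of being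
  alive. Nonnegativity of \<open>w\<close> bounds the telescoped sum by \<open>w x\<close>, whence summability; then
  the probabilities and with them \<open>M n\<close> tend to \<open>0\<close>.
\<close>

lemma sum_alive_bounds:
  assumes h: "0 < h" and w: "w z = 0" "\<And>a. 0 \<le> w a"
    and c: "0 < c1" 
    and drift1: "\<And>a. a \<noteq> z \<Longrightarrow> c1 * h \<le> w a - (\<Sum>b\<in>UNIV. transition h a b * w b)"
    and drift2: "\<And>a. a \<noteq> z \<Longrightarrow> w a - (\<Sum>b\<in>UNIV. transition h a b * w b) \<le> c2 * h"
  shows "summable (\<lambda>n. measure (P x) (alive h z x n))"
    and "c1 * (h * (\<Sum>n. measure (P x) (alive h z x n))) \<le> w x"
    and "w x \<le> c2 * (h * (\<Sum>n. measure (P x) (alive h z x n)))"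
proof -
  have h0: "0 \<le> h" using h by simp
  define q where "q n = measure (P x) (alive h z x n)" for n
  define M where "M n = (\<Sum>a\<in>UNIV. alive_at h z x n a * w a)" for n
  have q_nonneg: "0 \<le> q n" for n
    by (simp add: q_def)
  have at_nonneg: "0 \<le> alive_at h z x n a" for n a
    by (simp add: alive_at_def)
  have M_nonneg: "0 \<le> M n" for n
    unfolding M_def by (intro sum_nonneg mult_nonneg_nonneg at_nonneg w)
  have q_sum: "q n = (\<Sum>a\<in>UNIV. alive_at h z x n a)" for n
    by (simp add: q_def sum_alive_at[OF h0])
  have M0: "M 0 = w x"
    unfolding M_def alive_at_0 by (cases "x = z") (simp_all add: w(1) if_distrib[where f = "\<lambda>u. u * _"] cong: if_cong)
  have M_Suc: "M n - M (Suc n) = (\<Sum>a\<in>UNIV. alive_at h z x n a * (w a - (\<Sum>b\<in>UNIV. transition h a b * w b)))" for n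
  proof -
    have "M (Suc n) = (\<Sum>b\<in>UNIV. (\<Sum>a\<in>UNIV. alive_at h z x n a * transition h a b) * w b)"
      unfolding M_def
    proof (intro sum.cong refl)
      fix b
      show "alive_at h z x (Suc n) b * w b = (\<Sum>a\<in>UNIV. alive_at h z x n a * transition h a b) * w b"
        by (cases "b = z") (simp_all add: w(1) alive_at_Suc[OF h0])
    qed
    also have "\<dots> = (\<Sum>a\<in>UNIV. alive_at h z x n a * (\<Sum>b\<in>UNIV. transition h a b * w b))"
      unfolding sum_distrib_left sum_distrib_right by (subst sum.swap) (simp add: mult.assoc)
    finally show ?thesis
      by (simp add: M_def right_diff_distrib sum_subtractf)
  qed
  have step1: "c1 * h * q n \<le> M n - M (Suc n)" for n
    unfolding M_Suc q_sum sum_distrib_left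
  proof (intro sum_mono)
    fix a show "c1 * h * alive_at h z x n a \<le> alive_at h z x n a * (w a - (\<Sum>b\<in>UNIV. transition h a b * w b))"
      using mult_left_mono[OF drift1 at_nonneg, of a] 
      by (cases "a = z") (auto simp: alive_at_target mult_ac)
  qed
  have step2: "M n - M (Suc n) \<le> c2 * h * q n" for n
    unfolding M_Suc q_sum sum_distrib_left
  proof (intro sum_mono)
    fix a show "alive_at h z x n a * (w a - (\<Sum>b\<in>UNIV. transition h a b * w b)) \<le> c2 * h * alive_at h z x n a"
      using mult_left_mono[OF drift2 at_nonneg, of a] 
      by (cases "a = z") (auto simp: alive_at_target mult_ac)
  qed
  have tele1: "c1 * h * (\<Sum>i<n. q i) \<le> w x - M n" for n
  proof (induction n)
    case (Suc n) then show ?case using step1[of n] by (simp add: algebra_simps)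
  qed (simp add: M0)
  have tele2: "w x - M n \<le> c2 * h * (\<Sum>i<n. q i)" for n
  proof (induction n)
    case (Suc n) then show ?case using step2[of n] by (simp add: algebra_simps)
  qed (simp add: M0)
  have bound: "(\<Sum>i<n. q i) \<le> w x / (c1 * h)" for n
    using tele1[of n] M_nonneg[of n] h c by (simp add: pos_le_divide_eq mult_ac)
  then have sm: "summable q"
    by (intro bounded_imp_summable[where B = "w x / (c1 * h)"])
      (auto simp: q_nonneg lessThan_Suc_atMost[symmetric] simp del: sum.lessThan_Suc intro: bound)
  then show "summable (\<lambda>n. measure (P x) (alive h z x n))"
    by (simp add: q_def[abs_def])
  have lim_q: "(\<lambda>n. \<Sum>i<n. q i) \<longlonglongrightarrow> (\<Sum>n. q n)"
    using sm by (rule summable_LIMSEQ)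
  have M_le: "M n \<le> Max (range w) * q n" for n
    unfolding M_def q_sum sum_distrib_left
    by (intro sum_mono) (auto intro!: mult_right_mono at_nonneg simp: mult.commute[of _ "w _"])
  have "(\<lambda>n. Max (range w) * q n) \<longlonglongrightarrow> Max (range w) * 0"
    by (intro tendsto_intros summable_LIMSEQ_zero sm)
  then have "(\<lambda>n. Max (range w) * q n) \<longlonglongrightarrow> 0"
    by simp
  then have "M \<longlonglongrightarrow> 0"
    by (rule tendsto_sandwich[OF always_eventually always_eventually tendsto_const, rotated 2])
      (simp_all add: M_nonneg M_le)
  then have lim_M: "(\<lambda>n. w x - M n) \<longlonglongrightarrow> w x - 0"
    by (intro tendsto_intros)
  have "c1 * h * (\<Sum>n. q n) \<le> w x - 0"
    using tele1 by (intro LIMSEQ_le[OF tendsto_mult_left[OF lim_q] lim_M]) auto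
  then show "c1 * (h * (\<Sum>n. measure (P x) (alive h z x n))) \<le> w x"
    by (simp add: q_def mult_ac)
  have "w x - 0 \<le> c2 * h * (\<Sum>n. q n)"
    using tele2 by (intro LIMSEQ_le[OF lim_M tendsto_mult_left[OF lim_q]]) auto
  then show "w x \<le> c2 * (h * (\<Sum>n. measure (P x) (alive h z x n)))"
    by (simp add: q_def mult_ac)
qed


section \<open>First passage times as limits along dyadic grids\<close>

definition grid_passage_time :: "real \<Rightarrow> 'a \<Rightarrow> 'w \<Rightarrow> ennreal"
  where "grid_passage_time h z \<omega> = Inf (ennreal ` {real i * h |i. X (real i * h) \<omega> = z})"

text \<open>
  The number of steps before the first hit is the number of steps at which the path is still
  alive; this turns the expectation into the sum of survival probabilities.
\<close>

lemma grid_passage_time_series: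
  assumes h: "0 < h"
  shows "grid_passage_time h z \<omega> = (\<Sum>i. if \<forall>j\<le>i. X (real j * h) \<omega> \<noteq> z then ennreal h else 0)"
proof (cases "\<exists>i. X (real i * h) \<omega> = z")
  case False
  have "(\<Sum>i::nat. ennreal h) = \<top>"
  proof (rule ccontr)
    assume *: "(\<Sum>i::nat. ennreal h) \<noteq> \<top>"
    then have "summable (\<lambda>i::nat. h)"
      using h by (intro summable_suminf_not_top) auto
    then show False
      using h by (simp add: summable_const_iff)
  qed
  with False show ?thesis
    by (simp add: grid_passage_time_def)
next
  case True
  define N where "N = (LEAST i. X (real i * h) \<omega> = z)"
  have N: "X (real N * h) \<omega> = z"
    unfolding N_def using True by (rule LeastI_ex)
  have N_le: "N \<le> i" if "X (real i * h) \<omega> = z" for i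
    unfolding N_def using that by (rule Least_le)
  have before: "(\<forall>j\<le>i. X (real j * h) \<omega> \<noteq> z) \<longleftrightarrow> i < N" for i
  proof
    assume "\<forall>j\<le>i. X (real j * h) \<omega> \<noteq> z"
    then show "i < N"
      by (rule contrapos_pp) (use N in \<open>auto intro!: exI[of _ N]\<close>)
  next
    assume "i < N"
    show "\<forall>j\<le>i. X (real j * h) \<omega> \<noteq> z"
    proof (intro allI impI notI)
      fix j assume "j \<le> i" "X (real j * h) \<omega> = z"
      then show False
        using N_le[of j] \<open>i < N\<close> by simp
    qed
  qed
  have "(\<Sum>i. if \<forall>j\<le>i. X (real j * h) \<omega> \<noteq> z then ennreal h else 0) = (\<Sum>i<N. ennreal h)"
    unfolding before by (subst suminf_finite[of "{..<N}"]) auto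
  also have "\<dots> = ennreal (real N * h)"
    using h by (simp add: ennreal_mult ennreal_of_nat_eq_real_of_nat)
  also have "\<dots> = grid_passage_time h z \<omega>"
    unfolding grid_passage_time_def
    by (rule cInf_eq_minimum[symmetric]) (use N N_le h in \<open>auto intro!: ennreal_leI mult_right_mono\<close>)
  finally show ?thesis ..
qed

lemma grid_step_measurable:
  assumes "0 \<le> h"
  shows "(\<lambda>\<omega>. if \<forall>j\<le>i. X (real j * h) \<omega> \<noteq> z then ennreal h else 0) \<in> borel_measurable (P x)"
proof (rule measurable_If)
  show "{\<omega> \<in> space (P x). \<forall>j\<le>i. X (real j * h) \<omega> \<noteq> z} \<in> sets (P x)"
    using sets_alive[OF assms] unfolding alive_def .
qed simp_all

lemma grid_passage_time_measurable:
  assumes "0 < h"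
  shows "grid_passage_time h z \<in> borel_measurable (P x)"
  unfolding grid_passage_time_series[OF assms, abs_def]
  using assms by (intro borel_measurable_suminf_order grid_step_measurable) simp

lemma nn_integral_grid_passage_time:
  assumes h: "0 < h" and sm: "summable (\<lambda>n. measure (P x) (alive h z x n))"
  shows "(\<integral>\<^sup>+\<omega>. grid_passage_time h z \<omega> \<partial>P x) = ennreal (h * (\<Sum>n. measure (P x) (alive h z x n)))"
proof -
  interpret prob_space "P x" by (rule prob)
  have h0: "0 \<le> h" using h by simp
  have each: "(\<integral>\<^sup>+\<omega>. (if \<forall>j\<le>i. X (real j * h) \<omega> \<noteq> z then ennreal h else 0) \<partial>P x)
      = ennreal (h * prob (alive h z x i))" for i
  proof -
    have "(\<integral>\<^sup>+\<omega>. (if \<forall>j\<le>i. X (real j * h) \<omega> \<noteq> z then ennreal h else 0) \<partial>P x)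
        = (\<integral>\<^sup>+\<omega>. ennreal h * indicator (alive h z x i) \<omega> \<partial>P x)"
      by (intro nn_integral_cong) (auto simp: alive_def indicator_def)
    also have "\<dots> = ennreal h * emeasure (P x) (alive h z x i)"
      using sets_alive[OF h0] by (rule nn_integral_cmult_indicator)
    finally show ?thesis
      using h0 by (simp add: emeasure_eq_measure ennreal_mult)
  qed
  have "(\<integral>\<^sup>+\<omega>. grid_passage_time h z \<omega> \<partial>P x) = (\<Sum>i. ennreal (h * prob (alive h z x i)))"
    unfolding grid_passage_time_series[OF h] nn_integral_suminf[OF grid_step_measurable[OF h0]] each ..
  also have "\<dots> = ennreal (\<Sum>i. h * prob (alive h z x i))"
    using h0 sm by (intro suminf_ennreal2) (auto intro: summable_mult)
  finally show ?thesis
    by (simp add: suminf_mult[OF sm])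
qed

lemma grid_passage_time_halve: "grid_passage_time (h / 2) z \<omega> \<le> grid_passage_time h z \<omega>"
proof -
  have "{real i * h |i. X (real i * h) \<omega> = z} \<subseteq> {real i * (h / 2) |i. X (real i * (h / 2)) \<omega> = z}"
  proof clarify
    fix i assume "z = X (real i * h) \<omega>"
    then show "\<exists>j. real i * h = real j * (h / 2) \<and> X (real j * (h / 2)) \<omega> = X (real i * h) \<omega>"
      by (intro exI[of _ "2 * i"]) simp
  qed
  then show ?thesis
    unfolding grid_passage_time_def by (intro Inf_superset_mono image_mono)
qed

text \<open>
  A right-continuous path that is in \<open>z\<close> at time \<open>t\<close> stays there for a while, so a fine enough grid
  sees it in \<open>z\<close> shortly after \<open>t\<close>.
\<close>

lemma INF_grid_passage_time:
  assumes rc: "\<forall>t\<ge>0. \<forall>\<^sub>F s in at_right t. X s \<omega> = X t \<omega>"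
  shows "(INF n. grid_passage_time ((1/2) ^ n) z \<omega>) = first_passage_time X z \<omega>"
proof (rule antisym)
  show "first_passage_time X z \<omega> \<le> (INF n. grid_passage_time ((1/2) ^ n) z \<omega>)"
    unfolding first_passage_time_def grid_passage_time_def
    by (intro INF_greatest Inf_superset_mono image_mono) auto
next
  show "(INF n. grid_passage_time ((1/2) ^ n) z \<omega>) \<le> first_passage_time X z \<omega>"
    unfolding first_passage_time_def
  proof (rule Inf_greatest, clarify)
    fix t assume t: "0 \<le> t" "z = X t \<omega>"
    obtain d where d: "t < d" "\<And>s. t < s \<Longrightarrow> s < d \<Longrightarrow> X s \<omega> = X t \<omega>"
      using rc t(1) unfolding eventually_at_right_field by blast
    show "(INF n. grid_passage_time ((1/2) ^ n) (X t \<omega>) \<omega>) \<le> ennreal t"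
    proof (rule ennreal_le_epsilon)
      fix e :: real assume e: "0 < e"
      obtain n where n: "(1/2) ^ n < min (d - t) e"
        using real_arch_pow_inv[of "min (d - t) e" "1/2"] d(1) e by auto
      define h :: real where "h = (1/2) ^ n"
      \<comment> \<open>The first grid point strictly after \<open>t\<close>.\<close>
      define i where "i = nat (\<lfloor>t / h\<rfloor> + 1)"
      have h: "0 < h" "h < d - t" "h < e"
        using n by (auto simp: h_def)
      have "real i = of_int \<lfloor>t / h\<rfloor> + 1"
        using t(1) h by (simp add: i_def)
      then have "t / h < real i" "real i \<le> t / h + 1"
        by linarith+
      then have i: "t < real i * h" "real i * h \<le> t + h"
        using h(1) by (simp_all add: field_simps)
      have "grid_passage_time h (X t \<omega>) \<omega> \<le> ennreal (real i * h)"
        unfolding grid_passage_time_def using i h d(2)[of "real i * h"]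
        by (intro Inf_lower imageI) auto
      also have "\<dots> \<le> ennreal (t + e)"
        using i h by (intro ennreal_leI) auto
      finally show "(INF n. grid_passage_time ((1/2) ^ n) (X t \<omega>) \<omega>) \<le> ennreal t + ennreal e"
        using t(1) e unfolding h_def by (intro INF_lower2[of n]) auto
    qed
  qed
qed

text \<open>
  First-passage times need not be measurable where right-continuity fails, but they
  agree almost everywhere with a decreasing limit of grid passage times, which are measurable.
\<close>

lemma mean_first_passage_time_eqI:
  assumes w: "w z = 0" "\<And>x. 0 \<le> w x" "\<And>x. x \<noteq> z \<Longrightarrow> backward_generator k w x = -1"
  shows "mean_first_passage_time P X x z = w x"
proof -
  define h :: "nat \<Rightarrow> real" where "h n = (1/2) ^ n" for n
  define S where "S n = h n * (\<Sum>i. measure (P x) (alive (h n) z x i))" for n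
  have h_pos: "0 < h n" for n by (simp add: h_def)
  have h_lim: "filterlim h (at_right 0) sequentially"
    unfolding filterlim_at h_def[abs_def]
    by (auto intro!: LIMSEQ_realpow_zero)
  have drift: "\<forall>\<^sub>F n in sequentially. \<forall>a. a \<noteq> z \<longrightarrow>
      (1 - e) * h n \<le> w a - (\<Sum>b\<in>UNIV. transition (h n) a b * w b) \<and>
      w a - (\<Sum>b\<in>UNIV. transition (h n) a b * w b) \<le> (1 + e) * h n" if e: "0 < e" for e
  proof (rule eventually_all_finite)
    fix a
    show "\<forall>\<^sub>F n in sequentially. a \<noteq> z \<longrightarrow>
      (1 - e) * h n \<le> w a - (\<Sum>b\<in>UNIV. transition (h n) a b * w b) \<and>
      w a - (\<Sum>b\<in>UNIV. transition (h n) a b * w b) \<le> (1 + e) * h n"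
    proof (cases "a = z")
      case False
      have "(\<lambda>n. ((\<Sum>b\<in>UNIV. transition (h n) a b * w b) - w a) / h n) \<longlonglongrightarrow> -1"
        using filterlim_compose[OF drift_tendsto h_lim, of a w] w(3)[OF False] by simp
      from tendstoD[OF this e] show ?thesis
      proof eventually_elim
        case (elim n)
        then have "-1 - e \<le> ((\<Sum>b\<in>UNIV. transition (h n) a b * w b) - w a) / h n"
          "((\<Sum>b\<in>UNIV. transition (h n) a b * w b) - w a) / h n \<le> -1 + e"
          unfolding dist_real_def by linarith+
        then show ?case
          unfolding pos_le_divide_eq[OF h_pos] pos_divide_le_eq[OF h_pos] by (simp add: algebra_simps)
      qed
    qed simp
  qed
  have bounds: "\<forall>\<^sub>F n in sequentially. (\<integral>\<^sup>+\<omega>. grid_passage_time (h n) z \<omega> \<partial>P x) = ennreal (S n) \<and>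
      (1 - e) * S n \<le> w x \<and> w x \<le> (1 + e) * S n" if e: "0 < e" "e < 1" for e
    using drift[OF e(1)]
  proof eventually_elim
    case (elim n)
    have d: "(1 - e) * h n \<le> w a - (\<Sum>b\<in>UNIV. transition (h n) a b * w b)"
      "w a - (\<Sum>b\<in>UNIV. transition (h n) a b * w b) \<le> (1 + e) * h n" if "a \<noteq> z" for a
      using elim that by blast+
    have e1: "0 < 1 - e" using e by simp
    note A = sum_alive_bounds[where h = "h n" and w = w and z = z and x = x, OF h_pos w(1,2) e1 d]
    show ?case
      unfolding S_def
      by (intro conjI nn_integral_grid_passage_time h_pos A)
  qed
  have S_lim: "S \<longlonglongrightarrow> w x"
  proof (rule tendstoI)
    fix r :: real assume r: "0 < r"
    \<comment> \<open>Chosen so that \<open>\<bar>S n - w x\<bar> \<le> e * S n \<le> e * (2 * w x) < r\<close>, using \<open>S n \<le> 2 * w x\<close>.\<close>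
    define e where "e = min (1/2) (r / (2 * w x + 1))"
    have e: "0 < e" "e < 1" "e * (2 * w x) < r"
    proof -
      have pos: "0 < 2 * w x + 1"
        using w(2)[of x] by simp
      have "e \<le> r / (2 * w x + 1)"
        unfolding e_def by (rule min.cobounded2)
      then have "e * (2 * w x + 1) \<le> r"
        unfolding pos_le_divide_eq[OF pos] .
      moreover show "0 < e"
        unfolding e_def using divide_pos_pos[OF r pos] by simp
      ultimately show "e * (2 * w x) < r"
        by (simp add: distrib_left)
      show "e < 1"
        unfolding e_def by (rule min.strict_coboundedI1) simp
    qed
    have half: "(0::real) < 1/2" "(1/2::real) < 1" by auto
    show "\<forall>\<^sub>F n in sequentially. dist (S n) (w x) < r"
      using bounds[OF half] bounds[OF e(1,2)]
    proof eventually_elim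
      case (elim n)
      then have "\<bar>S n - w x\<bar> \<le> e * S n" "S n \<le> 2 * w x"
        by (simp_all add: abs_le_iff left_diff_distrib distrib_right)
      moreover have "e * S n \<le> e * (2 * w x)"
        using calculation(2) e(1) by (intro mult_left_mono) auto
      ultimately show ?case
        using e(3) by (simp add: dist_real_def)
    qed
  qed
  define G where "G n = (\<integral>\<^sup>+\<omega>. grid_passage_time (h n) z \<omega> \<partial>P x)" for n
  have halve: "grid_passage_time (h (Suc n)) z \<omega> \<le> grid_passage_time (h n) z \<omega>" for n \<omega>
    using grid_passage_time_halve[of "h n"] by (simp add: h_def)
  have G_eq: "\<forall>\<^sub>F n in sequentially. ennreal (S n) = G n"
    using bounds[of "1/2"] by (auto simp: G_def elim: eventually_mono)
  then obtain m where "ennreal (S m) = G m"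
    unfolding eventually_sequentially by blast
  then have finite_m: "G m < \<infinity>"
    by (metis ennreal_less_top infinity_ennreal_def)
  have "(\<integral>\<^sup>+\<omega>. first_passage_time X z \<omega> \<partial>P x) = (\<integral>\<^sup>+\<omega>. (INF n. grid_passage_time (h n) z \<omega>) \<partial>P x)"
  proof (rule nn_integral_cong_AE)
    show "AE \<omega> in P x. first_passage_time X z \<omega> = (INF n. grid_passage_time (h n) z \<omega>)"
      using right_continuous[of x]
      by eventually_elim (simp only: h_def INF_grid_passage_time)
  qed
  also have "\<dots> = (INF n. G n)"
    unfolding G_def
    by (rule nn_integral_monotone_convergence_INF_AE)
      (rule AE_I2 halve grid_passage_time_measurable h_pos finite_m[unfolded G_def])+
  also have "\<dots> = ennreal (w x)"
  proof (rule LIMSEQ_unique)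
    show "G \<longlonglongrightarrow> (INF n. G n)"
      unfolding G_def by (intro LIMSEQ_INF decseq_SucI nn_integral_mono halve)
    show "G \<longlonglongrightarrow> ennreal (w x)"
      using tendsto_ennrealI[OF S_lim] G_eq by (rule Lim_transform_eventually)
  qed
  finally show ?thesis
    unfolding mean_first_passage_time_def using w(2) by simp
qed

end

section \<open>The Poisson equation\<close>

theorem theoremV2:
  fixes k :: "'a::finite \<Rightarrow> 'a \<Rightarrow> real"
    and P :: "'a \<Rightarrow> 'w measure"
    and X :: "real \<Rightarrow> 'w \<Rightarrow> 'a"
    and rho :: "'a pmf"
    and f E hE V :: "'a \<Rightarrow> real"
    and D :: "'a set"
  assumes rates_nonneg: "\<And>x y. x \<noteq> y \<Longrightarrow> 0 \<le> k x y"
    and irreducible: "irreducible_rates k"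
    and process: "markov_jump_process k P X"
    and stationary: "stationary_distribution k rho"
    and centered: "(\<Sum>x\<in>UNIV. pmf rho x * f x) = 0"
    and decomposition: "\<And>x. f x = backward_generator k E x + hE x"
    and support: "\<And>x. x \<notin> D \<Longrightarrow> hE x = 0"
    and poisson: "\<And>x. backward_generator k V x + f x = 0"
  shows "\<bar>V x - V y\<bar> \<le> \<bar>E x - E y\<bar> + max_norm hE *
    (\<Sum>z\<in>D. pmf rho z *
      \<bar>mean_first_passage_time P X x z - mean_first_passage_time P X y z\<bar>)"
proof -
  interpret markov_jump_process k P X by (rule process)
  define \<tau> where "\<tau> = mean_first_passage_time P X"
  have \<tau>: "backward_generator k (\<lambda>x. \<tau> x z) x = -1" if "x \<noteq> z" for x z
  proof -
    obtain w where w: "w z = 0" "\<And>x. x \<noteq> z \<Longrightarrow> backward_generator k w x = -1" "\<And>x. 0 \<le> w x"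
      using ex_hitting_solution[OF rates_nonneg irreducible] by metis
    have "(\<lambda>x. \<tau> x z) = w"
      unfolding \<tau>_def using mean_first_passage_time_eqI w by blast
    then show ?thesis
      using w(2) that by simp
  qed
  have sum_rho: "(\<Sum>x\<in>UNIV. pmf rho x) = 1"
    by (rule sum_pmf_eq_1) auto
  have stat: "(\<Sum>x\<in>UNIV. pmf rho x * backward_generator k g x) = 0" for g
    using stationary unfolding stationary_distribution_def by blast
  \<comment> \<open>Off the diagonal this is the equation for \<open>\<tau>\<close>; on it, stationarity determines the value.\<close>
  have L_\<tau>: "pmf rho z * backward_generator k (\<lambda>x. \<tau> x z) x = (if x = z then 1 else 0) - pmf rho z" for x z
  proof (cases "x = z")
    case True
    have "0 = pmf rho z * backward_generator k (\<lambda>x. \<tau> x z) z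
        + (\<Sum>x\<in>UNIV - {z}. pmf rho x * backward_generator k (\<lambda>x. \<tau> x z) x)"
      using stat[of "\<lambda>x. \<tau> x z"] by (simp add: sum.remove[of UNIV z])
    also have "(\<Sum>x\<in>UNIV - {z}. pmf rho x * backward_generator k (\<lambda>x. \<tau> x z) x)
        = - (\<Sum>x\<in>UNIV - {z}. pmf rho x)"
      by (simp add: \<tau> sum_negf)
    also have "(\<Sum>x\<in>UNIV - {z}. pmf rho x) = 1 - pmf rho z"
      using sum_rho by (simp add: sum.remove[of UNIV z])
    finally show ?thesis
      using True by simp
  qed (simp add: \<tau>)
  have rho_hE: "(\<Sum>z\<in>UNIV. pmf rho z * hE z) = 0"
    using centered stat[of E] by (simp add: decomposition distrib_left sum.distrib)
  define U where "U x = (\<Sum>z\<in>UNIV. (hE z * pmf rho z) * \<tau> x z)" for x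
  have L_U: "backward_generator k U x = hE x" for x
  proof -
    have "backward_generator k U x = (\<Sum>z\<in>UNIV. hE z * ((if x = z then 1 else 0) - pmf rho z))"
      unfolding U_def backward_generator_sum backward_generator_scale mult.assoc L_\<tau> ..
    also have "\<dots> = hE x - (\<Sum>z\<in>UNIV. pmf rho z * hE z)"
      by (simp add: right_diff_distrib sum_subtractf mult.commute[of "hE _" "pmf rho _"]
          if_distrib[where f = "\<lambda>u. hE _ * u"] cong: if_cong)
    finally show ?thesis
      by (simp add: rho_hE)
  qed
  have harmonic: "backward_generator k (\<lambda>x. V x + (E x + U x)) x = 0" for x
    unfolding backward_generator_add L_U using poisson[of x] decomposition[of x] by simp
  have "V x + (E x + U x) = V y + (E y + U y)"
    by (rule harmonic_imp_const[where g = "\<lambda>x. V x + (E x + U x)"])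
      (rule rates_nonneg irreducible harmonic | assumption)+
  then have "\<bar>V x - V y\<bar> \<le> \<bar>E x - E y\<bar> + \<bar>U x - U y\<bar>"
    by linarith
  also have "U x - U y = (\<Sum>z\<in>UNIV. (hE z * pmf rho z) * (\<tau> x z - \<tau> y z))"
    unfolding U_def by (simp add: right_diff_distrib sum_subtractf)
  also have "\<dots> = (\<Sum>z\<in>D. (hE z * pmf rho z) * (\<tau> x z - \<tau> y z))"
    by (rule sum.mono_neutral_right) (auto simp: support)
  also have "\<bar>\<dots>\<bar> \<le> (\<Sum>z\<in>D. \<bar>(hE z * pmf rho z) * (\<tau> x z - \<tau> y z)\<bar>)"
    by (rule sum_abs)
  also have "\<dots> \<le> (\<Sum>z\<in>D. max_norm hE * (pmf rho z * \<bar>\<tau> x z - \<tau> y z\<bar>))"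
  proof (rule sum_mono)
    fix z
    have "\<bar>hE z\<bar> \<le> max_norm hE"
      unfolding max_norm_def by (rule Max_ge) auto
    then show "\<bar>(hE z * pmf rho z) * (\<tau> x z - \<tau> y z)\<bar> \<le> max_norm hE * (pmf rho z * \<bar>\<tau> x z - \<tau> y z\<bar>)"
      by (simp add: abs_mult mult.assoc mult_right_mono)
  qed
  finally show ?thesis
    by (simp add: \<tau>_def sum_distrib_left)
qed

end
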